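(* Let $n\in\mathbb{N}$ and let $(\mathbb{R}^n,\mathscr{M})$ be the Lebesgue measurable space, i.e. $\mathscr{M}$ is the $\sigma$-algebra of Lebesgue measurable subsets of $\mathbb{R}^n$. Then there is no free ultrafilter in $\mathscr{M}$ with the countable intersection property.
   Context: For a measurable space $(X,\mathscr{B})$: a non-empty $\mathscr{A}\subseteq\mathscr{B}$ is a filter-base in $\mathscr{B}$ if for every $A,B\in\mathscr{A}$ there is a non-empty $C\in\mathscr{A}$ with $C\subseteq A\cap B$. A filter $\mathscr{F}$ in $\mathscr{B}$ is a filter-base such that $B\in\mathscr{F}$ whenever $B\in\mathscr{B}$ and $F\subseteq B$ for some $F\in\mathscr{F}$. An ultrafilter in $\mathscr{B}$ is a maximal (with respect to $\subseteq$) filter in $\mathscr{B}$. An ultrafilter is free if the intersection of all its elements is empty. It has the countable intersection property if every countable collection of its elements has non-empty intersection. *)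

theory Defs
  imports "HOL-Analysis.Analysis"
begin

text \<open>
  The argument \<open>\<B>\<close> is the \<open>\<sigma>\<close>-algebra of a measurable space on the carrier
  \<open>\<Union>\<B>\<close>. Taking \<open>A = B = {}\<close> in the definition of a filter-base shows that the empty
  set is never a member.
\<close>

definition filter_base_in :: "'a set set \<Rightarrow> 'a set set \<Rightarrow> bool" where
  "filter_base_in \<B> \<A> \<longleftrightarrow>
     \<A> \<noteq> {} \<and> \<A> \<subseteq> \<B> \<and> (\<forall>A\<in>\<A>. \<forall>B\<in>\<A>. \<exists>C\<in>\<A>. C \<noteq> {} \<and> C \<subseteq> A \<inter> B)"

definition filter_in :: "'a set set \<Rightarrow> 'a set set \<Rightarrow> bool" where
  "filter_in \<B> \<F> \<longleftrightarrow>
     filter_base_in \<B> \<F> \<and> (\<forall>B\<in>\<B>. (\<exists>F\<in>\<F>. F \<subseteq> B) \<longrightarrow> B \<in> \<F>)"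

definition ultrafilter_in :: "'a set set \<Rightarrow> 'a set set \<Rightarrow> bool" where
  "ultrafilter_in \<B> \<U> \<longleftrightarrow>
     filter_in \<B> \<U> \<and> (\<forall>\<F>. filter_in \<B> \<F> \<longrightarrow> \<U> \<subseteq> \<F> \<longrightarrow> \<F> = \<U>)"

definition free_family :: "'a set set \<Rightarrow> bool" where
  "free_family \<U> \<longleftrightarrow> \<Inter>\<U> = {}"

text \<open>
  The empty subcollection is harmless, since \<open>\<Inter>{} = UNIV\<close> is non-empty.
\<close>

definition countable_intersection_property :: "'a set set \<Rightarrow> bool" where
  "countable_intersection_property \<U> \<longleftrightarrow>
     (\<forall>\<C>. \<C> \<subseteq> \<U> \<longrightarrow> countable \<C> \<longrightarrow> \<Inter>\<C> \<noteq> {})"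

end

theory Submission
  imports Defs
begin

text \<open>
  An ultrafilter of measurable sets contains each measurable set or its complement. Choosing in this
  way for every member of a countable base of a T1 topology gives countably many members of the
  ultrafilter whose intersection has at most one point \<open>x\<close>. Freeness forces \<open>- {x}\<close> into the
  ultrafilter, and adding this set to the chosen ones makes the intersection empty.
\<close>

text \<open>If some member misses \<open>B\<close>, it lies in the complement of \<open>B\<close>,
  which is then a member too. Otherwise the traces \<open>F \<inter> B\<close> of members generate a
  filter that contains both \<open>\<U>\<close> and \<open>B\<close>, and maximality makes it equal
  to \<open>\<U>\<close>.\<close>

lemma ultrafilter_in_dichotomy:
  assumes U: "ultrafilter_in (sets M) \<U>" and B: "B \<in> sets M"
  shows "B \<in> \<U> \<or> space M - B \<in> \<U>"
proof (cases "\<exists>F\<in>\<U>. F \<inter> B = {}")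
  case True
  then obtain F where F: "F \<in> \<U>" "F \<inter> B = {}" by blast
  have "F \<in> sets M"
    using U F by (auto simp: ultrafilter_in_def filter_in_def filter_base_in_def)
  then have "F \<subseteq> space M - B"
    using sets.sets_into_space F by blast
  then show ?thesis
    using U B F by (auto simp: ultrafilter_in_def filter_in_def)
next
  case False
  define \<G> where "\<G> = {C \<in> sets M. \<exists>F\<in>\<U>. F \<inter> B \<subseteq> C}"
  have base: "filter_base_in (sets M) \<U>"
    using U by (simp add: ultrafilter_in_def filter_in_def)
  then obtain F0 where F0: "F0 \<in> \<U>"
    by (auto simp: filter_base_in_def)
  have sub: "\<U> \<subseteq> \<G>" and BG: "B \<in> \<G>"
    using base B F0 by (auto simp: \<G>_def filter_base_in_def)
  have "\<exists>D\<in>\<G>. D \<noteq> {} \<and> D \<subseteq> C1 \<inter> C2" if C: "C1 \<in> \<G>" "C2 \<in> \<G>" for C1 C2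
  proof -
    obtain F1 F2 where F12: "F1 \<in> \<U>" "F1 \<inter> B \<subseteq> C1" "F2 \<in> \<U>" "F2 \<inter> B \<subseteq> C2"
      using C unfolding \<G>_def by blast
    then obtain F where F: "F \<in> \<U>" "F \<subseteq> F1 \<inter> F2"
      using base unfolding filter_base_in_def by blast
    then have "F \<in> sets M"
      using base by (auto simp: filter_base_in_def)
    then have "F \<inter> B \<in> \<G>"
      using F(1) B by (auto simp: \<G>_def)
    \<comment> \<open>Here the case assumption enters: every member of \<open>\<U>\<close> meets
      \<open>B\<close>.\<close>
    moreover have "F \<inter> B \<noteq> {}" "F \<inter> B \<subseteq> C1 \<inter> C2"
      using F F12 False by auto
    ultimately show ?thesis by (intro bexI[of _ "F \<inter> B"] conjI)
  qed
  moreover have "\<G> \<noteq> {}" "\<G> \<subseteq> sets M"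
    using BG by (auto simp: \<G>_def)
  ultimately have "filter_base_in (sets M) \<G>"
    unfolding filter_base_in_def by simp
  moreover have "C \<in> \<G>" if "C \<in> sets M" "D \<in> \<G>" "D \<subseteq> C" for C D
    using that order_trans[of _ D C] unfolding \<G>_def mem_Collect_eq by metis
  ultimately have "filter_in (sets M) \<G>"
    unfolding filter_in_def by metis
  then have "\<G> = \<U>"
    using U sub by (simp add: ultrafilter_in_def)
  then show ?thesis using BG by simp
qed

text \<open>The dichotomy is applied only to basic open sets and a singleton, so it is enough that
  \<open>M\<close> contains the Borel sets.\<close>

lemma no_free_ultrafilter_countable_intersection:
  fixes M :: "'a::{second_countable_topology, t1_space} measure"
  assumes borel: "sets borel \<subseteq> sets M"
    and U: "ultrafilter_in (sets M) \<U>"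
    and free: "free_family \<U>"
    and cip: "countable_intersection_property \<U>"
  shows False
proof -
  have space: "space M = UNIV"
    using borel sets.sets_into_space[of UNIV M] by (auto simp: subset_iff)
  have dich: "B \<in> \<U> \<or> - B \<in> \<U>" if "B \<in> sets borel" for B
    using ultrafilter_in_dichotomy[OF U, of B] that borel space
    by (auto simp: Compl_eq_Diff_UNIV)
  obtain \<B> :: "'a set set" where \<B>: "countable \<B>" "topological_basis \<B>"
    using ex_countable_basis by blast
  define c where "c b = (if b \<in> \<U> then b else - b)" for b
  have cU: "c ` \<B> \<subseteq> \<U>"
    using dich[OF borel_open] topological_basis_open[OF \<B>(2)] by (auto simp: c_def)
  obtain x where x: "x \<in> \<Inter>(c ` \<B>)"
    using cip cU \<B>(1) unfolding countable_intersection_property_def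
    by (metis countable_image ex_in_conv)
  \<comment> \<open>A basic set around \<open>x\<close> that misses \<open>y\<close> would rule out
    \<open>y\<close> if it is chosen, and \<open>x\<close> if its complement is.\<close>
  have "y = x" if y: "y \<in> \<Inter>(c ` \<B>)" for y
  proof (rule ccontr)
    assume "y \<noteq> x"
    then obtain V where "open V" "x \<in> V" "y \<notin> V"
      by (metis t1_space)
    then obtain b where "b \<in> \<B>" "x \<in> b" "y \<notin> b"
      using topological_basisE[OF \<B>(2)] by blast
    then show False
      using x y by (auto simp: c_def split: if_splits)
  qed
  \<comment> \<open>The contradiction is reached from the other side: the empty countable
    intersection excludes \<open>- {x}\<close>, so \<open>{x}\<close> is a member, yet by freeness
    some member \<open>F\<close> is disjoint from it.\<close>
  then have "\<Inter>(insert (- {x}) (c ` \<B>)) = {}" by auto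
  then have "- {x} \<notin> \<U>"
    using cip cU \<B>(1) unfolding countable_intersection_property_def
    by (metis countable_image countable_insert insert_subset)
  then have "{x} \<in> \<U>"
    using dich[of "{x}"] by auto
  moreover obtain F where "F \<in> \<U>" "x \<notin> F"
    using free by (auto simp: free_family_def)
  ultimately have "\<Inter>{{x}, F} \<noteq> {}"
    using cip unfolding countable_intersection_property_def
    by (metis countable_empty countable_insert empty_subsetI insert_subset)
  then show False using \<open>x \<notin> F\<close> by auto
qed

theorem corollary4p8:
  "\<not> (\<exists>\<U>. ultrafilter_in (sets (lebesgue :: (real ^ 'n) measure)) \<U>
        \<and> free_family \<U> \<and> countable_intersection_property \<U>)"
proof -
  \<comment> \<open>Lebesgue measure is the completion of \<open>lborel\<close>, and completion only
    adds measurable sets.\<close>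
  have "sets borel \<subseteq> sets (lebesgue :: (real ^ 'n) measure)"
    by (metis sets_completionI_sets sets_lborel subsetI)
  then show ?thesis
    using no_free_ultrafilter_countable_intersection by blast
qed

end
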